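(* Let $d\ge 14$. Form a random family $\mathcal{F}\subseteq\binom{[2d]}{d}$ as follows: for each pair $\{A,\bar A\}$ of complementary $d$-element subsets of $[2d]$, independently and uniformly at random include exactly one of $A,\bar A$ in $\mathcal{F}$. Then with positive probability, for every $A\in\binom{[2d]}{d}$ and every $X$ with $\emptyset\ne X\subsetneq A$ we have $X\in\mathcal{F}|_A$; i.e., with positive probability $\mathcal{F}$ almost shatters every $A\in\binom{[2d]}{d}$.
   Context: $\bar A=[2d]\setminus A$. For a family $\mathcal{F}$ and set $A$, $\mathcal{F}|_A=\{F\cap A:F\in\mathcal{F}\}$; $\mathcal{F}$ almost shatters $A$ if $\mathcal{F}|_A=2^A\setminus\{\emptyset\}$ or $\mathcal{F}|_A=2^A\setminus\{A\}$. *)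

theory Defs
  imports "HOL-Probability.Product_PMF"
begin

definition layer :: "nat \<Rightarrow> nat set set" where
  "layer d = {A. A \<subseteq> {1..2 * d} \<and> card A = d}"

definition compl_pairs :: "nat \<Rightarrow> nat set set set" where
  "compl_pairs d = (\<lambda>A. {A, {1..2 * d} - A}) ` layer d"

text \<open>
  A member of each complementary pair is drawn uniformly, independently over the pairs, and the
  family collects the drawn sets. The argument \<open>{}\<close> of \<^const>\<open>Pi_pmf\<close> is the irrelevant value
  outside \<open>compl_pairs d\<close>.
\<close>

definition random_family :: "nat \<Rightarrow> nat set set pmf" where
  "random_family d =
     map_pmf (\<lambda>f. f ` compl_pairs d) (Pi_pmf (compl_pairs d) {} (\<lambda>P. pmf_of_set P))"

definition restriction :: "'a set set \<Rightarrow> 'a set \<Rightarrow> 'a set set" where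
  "restriction \<F> A = (\<lambda>F. F \<inter> A) ` \<F>"

definition almost_shatters :: "'a set set \<Rightarrow> 'a set \<Rightarrow> bool" where
  "almost_shatters \<F> A \<longleftrightarrow> restriction \<F> A = Pow A - {{}} \<or> restriction \<F> A = Pow A - {A}"

end

theory Submission
  imports Defs
begin

text \<open>
  The asymmetric Lovasz local lemma is applied to the independent choices from the complementary
  pairs. For \<open>2 \<le> card X \<le> d - 2\<close> the bad event that no picked set has trace \<open>X\<close> on \<open>A\<close> has
  probability at most \<open>2 ^ - (d choose 2)\<close>, so its weight may be taken so small that all these
  events may be regarded as neighbours of everything. The traces with \<open>card X = 1\<close> or \<open>card X = d - 1\<close>
  are controlled together: writing \<open>B\<close> for the complement of \<open>A\<close> with the exceptional point of \<open>A\<close>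
  added, both only require that among the \<open>d + 1\<close> sets \<open>B - {y}\<close> at least two are picked and
  at least two are not. This fails with probability \<open>(d + 2) / 2 ^ d\<close>, and the event for \<open>B\<close>
  shares a pair with at most \<open>(d + 1) (3 d - 2) / 2\<close> others, which is few enough
  exactly when \<open>d \<ge> 14\<close>.
\<close>

section \<open>The asymmetric Lovasz local lemma\<close>

text \<open>The Weierstrass product inequality; it controls the factor contributed by very many
  neighbours of tiny weight.\<close>

lemma one_minus_sum_le_prod:
  fixes x :: "'a \<Rightarrow> real"
  assumes "\<And>i. i \<in> I \<Longrightarrow> 0 \<le> x i" "\<And>i. i \<in> I \<Longrightarrow> x i \<le> 1"
  shows "1 - (\<Sum>i\<in>I. x i) \<le> (\<Prod>i\<in>I. 1 - x i)"
  using assms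
proof (induction I rule: infinite_finite_induct)
  case (insert i I)
  have le1: "(\<Prod>j\<in>I. 1 - x j) \<le> 1"
    using insert.prems by (intro prod_le_1) auto
  have "1 - (\<Sum>j\<in>insert i I. x j) \<le> (\<Prod>j\<in>I. 1 - x j) - x i * 1"
    using insert by simp
  also have "\<dots> \<le> (\<Prod>j\<in>I. 1 - x j) - x i * (\<Prod>j\<in>I. 1 - x j)"
    using le1 insert.prems(1)[of i] by (intro diff_left_mono mult_left_mono) auto
  finally show ?case
    using insert.hyps by (simp add: algebra_simps)
qed auto

text \<open>Independence is stated only for jointly avoiding the events of \<open>J\<close>, which
  is the form the induction consumes. \<open>N i\<close> may contain \<open>i\<close> itself; this
  merely strengthens \<open>bound\<close>.\<close>

theorem (in prob_space) lovasz_local_lemma: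
  fixes E :: "'i \<Rightarrow> 'a set" and x :: "'i \<Rightarrow> real" and N :: "'i \<Rightarrow> 'i set"
  assumes fin: "finite I" and E: "\<And>i. i \<in> I \<Longrightarrow> E i \<in> events"
    and x: "\<And>i. i \<in> I \<Longrightarrow> 0 \<le> x i \<and> x i < 1"
    and N: "\<And>i. i \<in> I \<Longrightarrow> N i \<subseteq> I"
    and bound: "\<And>i. i \<in> I \<Longrightarrow> prob (E i) \<le> x i * (\<Prod>j\<in>N i. 1 - x j)"
    and indep: "\<And>i J. i \<in> I \<Longrightarrow> J \<subseteq> I - N i - {i} \<Longrightarrow>
      prob (E i \<inter> (space M - (\<Union>j\<in>J. E j))) = prob (E i) * prob (space M - (\<Union>j\<in>J. E j))"
  shows "prob (space M - (\<Union>i\<in>I. E i)) > 0"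
proof -
  define G where "G S = space M - (\<Union>j\<in>S. E j)" for S
  have G_events [simp, intro]: "G S \<in> events" if "S \<subseteq> I" for S
    unfolding G_def using that E fin by (intro sets.Diff sets.top sets.finite_UN) (auto intro: finite_subset)
  have G_insert: "prob (G (insert j S)) = prob (G S) - prob (E j \<inter> G S)"
    if "j \<in> I" "S \<subseteq> I" for j S
  proof -
    have "G (insert j S) = G S - (E j \<inter> G S)"
      by (auto simp: G_def)
    then show ?thesis
      using that E finite_measure_Diff[of "G S" "E j \<inter> G S"] sets.Int[of "E j" M "G S"] by simp
  qed
  \<comment> \<open>The telescoped chain rule: avoiding the events of \<open>U\<close> one after
    another costs a factor \<open>1 - x j\<close> each. \<open>small\<close> concerns only proper
    subsets of \<open>S \<union> U\<close>, so that an induction hypothesis can supply it.\<close>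
  have chain: "(\<Prod>j\<in>U. 1 - x j) * prob (G S) \<le> prob (G (S \<union> U))"
    if "finite U" "S \<union> U \<subseteq> I" "S \<inter> U = {}"
      and small: "\<And>j T. j \<in> U \<Longrightarrow> S \<subseteq> T \<Longrightarrow> T \<subset> S \<union> U \<Longrightarrow> j \<notin> T \<Longrightarrow>
        prob (E j \<inter> G T) \<le> x j * prob (G T)" for S U
    using that
  proof (induction U rule: finite_induct)
    case (insert j U)
    have IH: "(\<Prod>j\<in>U. 1 - x j) * prob (G S) \<le> prob (G (S \<union> U))"
      using insert.prems by (intro insert.IH) auto
    have "(\<Prod>j\<in>insert j U. 1 - x j) * prob (G S) = (1 - x j) * ((\<Prod>j\<in>U. 1 - x j) * prob (G S))"
      using insert.hyps by simp
    also have "\<dots> \<le> (1 - x j) * prob (G (S \<union> U))"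
      using IH x[of j] insert.prems by (intro mult_left_mono) auto
    also have "\<dots> \<le> prob (G (S \<union> U)) - prob (E j \<inter> G (S \<union> U))"
      using insert.prems(3)[of j "S \<union> U"] insert.prems(2) insert.hyps by (auto simp: algebra_simps)
    also have "\<dots> = prob (G (S \<union> insert j U))"
      using insert.prems by (subst G_insert[symmetric]) auto
    finally show ?case .
  qed auto
  \<comment> \<open>The usual bound on a conditional probability, multiplied out so that positivity
    of \<open>prob (G S)\<close> need not be carried along.\<close>
  have key: "prob (E i \<inter> G S) \<le> x i * prob (G S)" if "S \<subseteq> I" "i \<in> I" "i \<notin> S" for i S
    using finite_subset[OF that(1) fin] that
  proof (induction S arbitrary: i rule: finite_psubset_induct)
    case (psubset S)
    define S1 S2 where "S1 = S \<inter> N i" and "S2 = S - N i"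
    have S_eq: "S2 \<union> S1 = S"
      by (auto simp: S1_def S2_def)
    have S: "finite S1" "S2 \<subseteq> S" "S2 \<inter> S1 = {}" "S1 \<subseteq> I" "S2 \<subseteq> I" "S1 \<subseteq> N i"
      using psubset.prems psubset.hyps by (auto simp: S1_def S2_def)
    \<comment> \<open>Forgetting the neighbours \<open>S1\<close> enlarges the event and leaves one
      that is independent of \<open>E i\<close>.\<close>
    have "prob (E i \<inter> G S) \<le> prob (E i \<inter> G S2)"
      using S(2,5) E psubset.prems by (intro finite_measure_mono sets.Int G_events) (auto simp: G_def)
    also have "\<dots> = prob (E i) * prob (G S2)"
      unfolding G_def using psubset.prems S by (intro indep) (auto simp: S2_def)
    also have "\<dots> \<le> (x i * (\<Prod>j\<in>N i. 1 - x j)) * prob (G S2)"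
      using bound[of i] psubset.prems by (intro mult_right_mono) auto
    also have "\<dots> \<le> (x i * (\<Prod>j\<in>S1. 1 - x j)) * prob (G S2)"
    proof (intro mult_right_mono mult_left_mono)
      have finN: "finite (N i)"
        using N[of i] psubset.prems fin finite_subset by blast
      have "(\<Prod>j\<in>N i. 1 - x j) = (\<Prod>j\<in>N i - S1. 1 - x j) * (\<Prod>j\<in>S1. 1 - x j)"
        using S(6) finN by (rule prod.subset_diff)
      also have "\<dots> \<le> 1 * (\<Prod>j\<in>S1. 1 - x j)"
        using N[of i] psubset.prems x S(4)
        by (intro mult_right_mono prod_le_1 prod_nonneg) (auto simp: less_imp_le dest!: subsetD)
      finally show "(\<Prod>j\<in>N i. 1 - x j) \<le> (\<Prod>j\<in>S1. 1 - x j)" by simp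
    qed (use x psubset.prems in auto)
    also have "\<dots> = x i * ((\<Prod>j\<in>S1. 1 - x j) * prob (G S2))"
      by simp
    \<comment> \<open>The neighbours come back at the price of their factors, by
      \<open>chain\<close> and the induction hypothesis for proper subsets of
      \<open>S\<close>.\<close>
    also have "\<dots> \<le> x i * prob (G (S2 \<union> S1))"
    proof (intro mult_left_mono chain)
      fix j T assume "j \<in> S1" "S2 \<subseteq> T" "T \<subset> S2 \<union> S1" "j \<notin> T"
      then show "prob (E j \<inter> G T) \<le> x j * prob (G T)"
        using psubset.IH[of T j] S psubset.prems(1) unfolding S_eq by blast
    qed (use S psubset.prems x in auto)
    finally show ?case
      unfolding S_eq .
  qed
  have "0 < (\<Prod>j\<in>I. 1 - x j)"
    using x by (intro prod_pos) auto
  also have "\<dots> = (\<Prod>j\<in>I. 1 - x j) * prob (G {})"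
    by (simp add: G_def prob_space)
  also have "\<dots> \<le> prob (G ({} \<union> I))"
    using fin by (intro chain key) auto
  finally show ?thesis
    by (simp add: G_def)
qed

section \<open>Independence of events that read disjoint sets of coordinates\<close>

definition determined_on :: "'a set \<Rightarrow> ('a \<Rightarrow> 'b) set \<Rightarrow> bool" where
  "determined_on D E \<longleftrightarrow> (\<forall>f g. (\<forall>x\<in>D. f x = g x) \<longrightarrow> f \<in> E \<longleftrightarrow> g \<in> E)"

lemma determined_onD: "determined_on D E \<Longrightarrow> (\<And>x. x \<in> D \<Longrightarrow> f x = g x) \<Longrightarrow> f \<in> E \<longleftrightarrow> g \<in> E"
  by (auto simp: determined_on_def)

lemma determined_on_not_Union:
  assumes "\<And>j. j \<in> J \<Longrightarrow> determined_on (D j) (E j)" "\<And>j. j \<in> J \<Longrightarrow> D j \<subseteq> C"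
  shows "determined_on C (- (\<Union>j\<in>J. E j))"
  unfolding determined_on_def
proof (intro allI impI)
  fix f g :: "'b \<Rightarrow> 'c" assume eq: "\<forall>x\<in>C. f x = g x"
  have "f \<in> E j \<longleftrightarrow> g \<in> E j" if "j \<in> J" for j
    using assms that eq by (intro determined_onD) auto
  then show "f \<in> - (\<Union>j\<in>J. E j) \<longleftrightarrow> g \<in> - (\<Union>j\<in>J. E j)"
    by auto
qed

lemma measure_pair_pmf_Times:
  "measure_pmf.prob (pair_pmf p q) (A \<times> B) = measure_pmf.prob p A * measure_pmf.prob q B"
proof -
  \<comment> \<open>\<open>measure_pmf_prob_product\<close> asks for countable sets, hence the
    passage to the supports.\<close>
  have "measure_pmf.prob (pair_pmf p q) (A \<times> B) =
      measure_pmf.prob (pair_pmf p q) ((A \<inter> set_pmf p) \<times> (B \<inter> set_pmf q))"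
    by (subst (1 2) measure_Int_set_pmf[symmetric]) (auto intro!: arg_cong2[where f = measure])
  also have "\<dots> = measure_pmf.prob p (A \<inter> set_pmf p) * measure_pmf.prob q (B \<inter> set_pmf q)"
    by (intro measure_pmf_prob_product) auto
  finally show ?thesis
    by (simp add: measure_Int_set_pmf)
qed

text \<open>Drawing the coordinates in \<open>C\<close> and those in \<open>A - C\<close> separately
  turns \<open>E\<close> and \<open>F\<close> into conditions on the two different components of a
  pair.\<close>

lemma Pi_pmf_determined_on_indep:
  assumes "finite A" "C \<subseteq> A" "D \<subseteq> A" "C \<inter> D = {}" "determined_on C E" "determined_on D F"
  shows "measure_pmf.prob (Pi_pmf A dflt p) (E \<inter> F) =
    measure_pmf.prob (Pi_pmf A dflt p) E * measure_pmf.prob (Pi_pmf A dflt p) F"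
proof -
  define h where "h = (\<lambda>(f, g) x. if x \<in> C then f x else (g x :: 'b))"
  define q where "q = pair_pmf (Pi_pmf C dflt p) (Pi_pmf (A - C) dflt p)"
  have A: "Pi_pmf A dflt p = map_pmf h q"
    using Pi_pmf_union[of C "A - C" dflt p] assms finite_subset[of C A]
    by (simp add: h_def q_def Un_absorb1)
  have "h (f, g) \<in> E \<longleftrightarrow> f \<in> E" for f g
    by (intro determined_onD[OF assms(5)]) (auto simp: h_def)
  then have E: "h -` E = E \<times> UNIV"
    by auto
  have "h (f, g) \<in> F \<longleftrightarrow> g \<in> F" for f g
    using assms by (intro determined_onD[OF assms(6)]) (auto simp: h_def)
  then have F: "h -` F = UNIV \<times> F"
    by auto
  have EF: "h -` (E \<inter> F) = E \<times> F"
    unfolding vimage_Int E F by auto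
  show ?thesis
    unfolding A measure_map_pmf E F EF
    unfolding q_def measure_pair_pmf_Times by simp
qed

section \<open>Choices from complementary pairs\<close>

definition compl_pair :: "nat \<Rightarrow> nat set \<Rightarrow> nat set set" where
  "compl_pair d S = {S, {1..2 * d} - S}"

text \<open>The law of the choice function before its image is taken; the independence of the pairs
  is visible only at this level.\<close>

definition choice_pmf :: "nat \<Rightarrow> (nat set set \<Rightarrow> nat set) pmf" where
  "choice_pmf d = Pi_pmf (compl_pairs d) {} (\<lambda>P. pmf_of_set P)"

text \<open>Membership of a layer set in the family (see \<open>picked_family\<close>), phrased so
  that it reads a single coordinate of \<open>f\<close>.\<close>

definition picks :: "nat \<Rightarrow> (nat set set \<Rightarrow> nat set) \<Rightarrow> nat set \<Rightarrow> bool" where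
  "picks d f S \<longleftrightarrow> f (compl_pair d S) = S"

lemma compl_pairs_eq: "compl_pairs d = compl_pair d ` layer d"
  by (simp add: compl_pairs_def compl_pair_def)

lemma finite_layer [simp]: "finite (layer d)"
  by (rule finite_subset[of _ "Pow {1..2 * d}"]) (auto simp: layer_def)

lemma finite_compl_pairs [simp]: "finite (compl_pairs d)"
  by (simp add: compl_pairs_eq)

lemma layerD:
  assumes "A \<in> layer d"
  shows "finite A" "card A = d" "A \<subseteq> {1..2 * d}"
  using assms finite_subset[of A "{1..2 * d}"] by (auto simp: layer_def)

lemma layer_compl: "A \<in> layer d \<Longrightarrow> {1..2 * d} - A \<in> layer d"
  by (auto simp: layer_def card_Diff_subset finite_subset[of _ "{1..2 * d}"])

lemma layer_neq_compl: "A \<in> layer d \<Longrightarrow> d > 0 \<Longrightarrow> {1..2 * d} - A \<noteq> A"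
  by (cases "A = {}") (auto simp: layer_def)

lemma compl_pair_compl: "A \<in> layer d \<Longrightarrow> compl_pair d ({1..2 * d} - A) = compl_pair d A"
  by (auto simp: layer_def compl_pair_def)

lemma compl_pair_eqD: "compl_pair d S = compl_pair d T \<Longrightarrow> S = T \<or> S = {1..2 * d} - T"
  by (auto simp: compl_pair_def)

text \<open>Intersecting sets are never complementary, so an intersecting family occupies pairwise
  distinct pairs.\<close>

lemma inj_on_compl_pair:
  assumes "\<And>S T. S \<in> \<S> \<Longrightarrow> T \<in> \<S> \<Longrightarrow> S \<inter> T \<noteq> {}"
  shows "inj_on (compl_pair d) \<S>"
proof (rule inj_onI)
  fix S T assume "S \<in> \<S>" "T \<in> \<S>" "compl_pair d S = compl_pair d T"
  then show "S = T"
    using assms[of S T] compl_pair_eqD[of d S T] by auto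
qed

lemma prob_pick_or_not:
  assumes "S \<in> layer d" "d > 0"
  shows "measure_pmf.prob (pmf_of_set (compl_pair d S)) {v. (v = S) = b} = 1 / 2"
proof -
  have "compl_pair d S \<inter> {v. (v = S) = b} = (if b then {S} else {{1..2 * d} - S})"
    using layer_neq_compl[OF assms] by (auto simp: compl_pair_def)
  moreover have "card (compl_pair d S) = 2"
    using layer_neq_compl[OF assms] by (simp add: compl_pair_def)
  moreover have "compl_pair d S \<noteq> {}" "finite (compl_pair d S)"
    by (simp_all add: compl_pair_def)
  ultimately show ?thesis
    by (simp add: measure_pmf_of_set)
qed

text \<open>The members of an intersecting family belong to different pairs and are therefore picked
  independently with probability \<open>1 / 2\<close>; every pattern \<open>c\<close> is equally
  likely.\<close>

lemma prob_picks_pattern: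
  assumes "\<S> \<subseteq> layer d" "d > 0" "\<And>S T. S \<in> \<S> \<Longrightarrow> T \<in> \<S> \<Longrightarrow> S \<inter> T \<noteq> {}"
  shows "measure_pmf.prob (choice_pmf d) {f. \<forall>S\<in>\<S>. picks d f S = c S} = (1 / 2) ^ card \<S>"
proof -
  \<comment> \<open>The constraint that the pattern puts on coordinate \<open>P\<close>; it comes
    from at most one \<open>S\<close>, and is void if \<open>P\<close> is not in
    \<open>\<D>\<close>.\<close>
  define V where "V P = {v. \<forall>S\<in>\<S>. compl_pair d S = P \<longrightarrow> (v = S) = c S}" for P
  define \<D> where "\<D> = compl_pair d ` \<S>"
  have inj: "inj_on (compl_pair d) \<S>"
    using assms(3) by (rule inj_on_compl_pair)
  have sub: "\<D> \<subseteq> compl_pairs d"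
    using assms(1) by (auto simp: \<D>_def compl_pairs_eq)
  have "{f. \<forall>S\<in>\<S>. picks d f S = c S} = Pi (compl_pairs d) V"
    using assms(1) by (auto simp: V_def Pi_def picks_def compl_pairs_eq)
  then have "measure_pmf.prob (choice_pmf d) {f. \<forall>S\<in>\<S>. picks d f S = c S} =
      (\<Prod>P\<in>compl_pairs d. measure_pmf.prob (pmf_of_set P) (V P))"
    by (simp add: choice_pmf_def measure_Pi_pmf_Pi)
  also have "\<dots> = (\<Prod>P\<in>compl_pairs d. if P \<in> \<D> then 1 / 2 else 1)"
  proof (rule prod.cong)
    fix P assume "P \<in> compl_pairs d"
    show "measure_pmf.prob (pmf_of_set P) (V P) = (if P \<in> \<D> then 1 / 2 else 1)"
    proof (cases "P \<in> \<D>")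
      case True
      then obtain S where S: "S \<in> \<S>" "P = compl_pair d S"
        by (auto simp: \<D>_def)
      then have "V P = {v. (v = S) = c S}"
        using inj by (auto simp: V_def dest: inj_onD)
      then show ?thesis
        using True S assms prob_pick_or_not[of S d "c S"] by auto
    next
      case False
      then have "V P = UNIV"
        by (auto simp: V_def \<D>_def)
      then show ?thesis
        using False by simp
    qed
  qed simp
  also have "\<dots> = (1 / 2) ^ card \<D>"
    using sub by (simp add: prod.If_cases Int_absorb1)
  also have "card \<D> = card \<S>"
    using inj by (simp add: \<D>_def card_image)
  finally show ?thesis .
qed

section \<open>The bad events and their probabilities\<close>

text \<open>For \<open>card B = d + 1\<close>, a count below 2 means at most one picked facet, and a
  count of at least \<open>d\<close> means at most one facet that is not picked.\<close>

definition near_constant :: "nat \<Rightarrow> nat set \<Rightarrow> (nat set set \<Rightarrow> nat set) set" where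
  "near_constant d B = {f. card {y \<in> B. picks d f (B - {y})} \<notin> {2..<d}}"

definition missed :: "nat \<Rightarrow> nat set \<times> nat set \<Rightarrow> (nat set set \<Rightarrow> nat set) set" where
  "missed d = (\<lambda>(A, X). {f. \<forall>Y. Y \<subseteq> {1..2 * d} - A \<and> card Y = d - card X \<longrightarrow> \<not> picks d f (X \<union> Y)})"

definition facets :: "'a set \<Rightarrow> 'a set set" where
  "facets B = (\<lambda>y. B - {y}) ` B"

text \<open>For \<open>A\<close> in the layer and \<open>X \<subseteq> A\<close>, these are the
  layer sets with trace \<open>X\<close> on \<open>A\<close>.\<close>

definition extensions :: "nat \<Rightarrow> nat set \<times> nat set \<Rightarrow> nat set set" where
  "extensions d = (\<lambda>(A, X). (\<lambda>Y. X \<union> Y) ` {Y. Y \<subseteq> {1..2 * d} - A \<and> card Y = d - card X})"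

lemma missed_eq: "missed d Q = {f. \<forall>S\<in>extensions d Q. \<not> picks d f S}"
  by (cases Q) (auto simp: missed_def extensions_def)

lemma determined_on_near_constant:
  "determined_on (compl_pair d ` facets B) (near_constant d B)"
  unfolding determined_on_def
proof (intro allI impI)
  fix f g :: "nat set set \<Rightarrow> nat set"
  assume "\<forall>P\<in>compl_pair d ` facets B. f P = g P"
  then have "{y \<in> B. picks d f (B - {y})} = {y \<in> B. picks d g (B - {y})}"
    by (auto simp: picks_def facets_def)
  then show "f \<in> near_constant d B \<longleftrightarrow> g \<in> near_constant d B"
    by (simp add: near_constant_def)
qed

lemma determined_on_missed:
  "determined_on (compl_pair d ` extensions d Q) (missed d Q)"
  unfolding determined_on_def
proof (intro allI impI)
  fix f g :: "nat set set \<Rightarrow> nat set"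
  assume "\<forall>P\<in>compl_pair d ` extensions d Q. f P = g P"
  then have "picks d f S \<longleftrightarrow> picks d g S" if "S \<in> extensions d Q" for S
    using that by (simp add: picks_def)
  then show "f \<in> missed d Q \<longleftrightarrow> g \<in> missed d Q"
    by (cases Q) (simp add: missed_eq)
qed

lemma facets_subset_layer:
  assumes "B \<subseteq> {1..2 * d}" "card B = d + 1"
  shows "facets B \<subseteq> layer d"
  using assms by (auto simp: facets_def layer_def)

lemma card_facets: "card (facets B) = card B"
  unfolding facets_def by (intro card_image inj_onI) auto

text \<open>Two facets together omit at most two points of \<open>B\<close>. This makes
  \<open>prob_picks_pattern\<close> applicable to them.\<close>

lemma facets_intersect:
  assumes "S \<in> facets B" "T \<in> facets B" "card B \<ge> 3"
  shows "S \<inter> T \<noteq> {}"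
proof
  from assms obtain x y where xy: "S = B - {x}" "T = B - {y}"
    by (auto simp: facets_def)
  assume "S \<inter> T = {}"
  then have "B \<subseteq> {x, y}"
    using xy by auto
  then have "card B \<le> card {x, y}"
    by (intro card_mono) auto
  then show False
    using assms(3) card_insert_le_m1[of 2 "{y}" x] by simp
qed

text \<open>A union bound over the possible sets of picked indices: the empty set, \<open>B\<close>,
  the singletons and their complements in \<open>B\<close>. These are at most
  \<open>2 * (d + 2)\<close> patterns, each of probability \<open>(1 / 2) ^ (d + 1)\<close>.\<close>

lemma prob_near_constant:
  assumes B: "B \<subseteq> {1..2 * d}" "card B = d + 1" and d: "d \<ge> 2"
  shows "measure_pmf.prob (choice_pmf d) (near_constant d B) \<le> (real d + 2) / 2 ^ d"
proof -
  define \<T> where "\<T> = {T. T \<subseteq> B \<and> card T \<notin> {2..<d}}"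
  define W where "W T = {f. {y \<in> B. picks d f (B - {y})} = T}" for T
  have finB: "finite B"
    using B finite_subset by blast
  then have fin: "finite \<T>"
    by (auto simp: \<T>_def)
  have W: "measure_pmf.prob (choice_pmf d) (W T) = (1 / 2) ^ (d + 1)" if "T \<in> \<T>" for T
  proof -
    have "W T = {f. \<forall>S\<in>facets B. picks d f S = (S \<in> (\<lambda>y. B - {y}) ` T)}"
      using that by (auto simp: W_def facets_def \<T>_def)
    also have "measure_pmf.prob (choice_pmf d) \<dots> = (1 / 2) ^ card (facets B)"
      using facets_subset_layer[OF B] facets_intersect[of _ B] B d
      by (intro prob_picks_pattern) auto
    finally show ?thesis
      by (simp add: card_facets B)
  qed
  have "\<T> \<subseteq> insert {} (insert B ((\<lambda>y. {y}) ` B \<union> (\<lambda>y. B - {y}) ` B))"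
  proof
    fix T assume T: "T \<in> \<T>"
    then have TB: "T \<subseteq> B" "finite T" "card T = 0 \<or> card T = 1 \<or> card T \<ge> d"
      using finB finite_subset by (auto simp: \<T>_def)
    have "card (B - T) + card T = d + 1"
      using TB B finB card_mono[of B T] by (simp add: card_Diff_subset)
    then consider "card T = 0" | "card T = 1" | "card (B - T) = 0" | "card (B - T) = 1"
      using TB by linarith
    then show "T \<in> insert {} (insert B ((\<lambda>y. {y}) ` B \<union> (\<lambda>y. B - {y}) ` B))"
    proof cases
      case 1 then show ?thesis using TB by simp
    next
      case 2 then show ?thesis using TB by (auto simp: card_1_singleton_iff)
    next
      case 3 then show ?thesis using TB finB by auto
    next
      case 4
      then obtain y where "B - T = {y}"
        by (auto simp: card_1_singleton_iff)
      then have "y \<in> B" "T = B - {y}"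
        using TB by auto
      then show ?thesis by auto
    qed
  qed
  then have "card \<T> \<le> card (insert {} (insert B ((\<lambda>y. {y}) ` B \<union> (\<lambda>y. B - {y}) ` B)))"
    using finB by (intro card_mono) auto
  also have "\<dots> \<le> Suc (Suc (card ((\<lambda>y. {y}) ` B) + card ((\<lambda>y. B - {y}) ` B)))"
    using finB card_Un_le[of "(\<lambda>y. {y}) ` B" "(\<lambda>y. B - {y}) ` B"] by (simp add: card_insert_if)
  also have "\<dots> \<le> 2 * (d + 2)"
    using card_image_le[OF finB, of "\<lambda>y. {y}"] card_image_le[OF finB, of "\<lambda>y. B - {y}"] B by simp
  finally have card: "card \<T> \<le> 2 * (d + 2)" .
  have "near_constant d B = (\<Union>T\<in>\<T>. W T)"
    by (auto simp: near_constant_def \<T>_def W_def)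
  then have "measure_pmf.prob (choice_pmf d) (near_constant d B) \<le>
      (\<Sum>T\<in>\<T>. measure_pmf.prob (choice_pmf d) (W T))"
    using fin by (auto intro!: measure_UNION_le)
  also have "\<dots> = card \<T> * (1 / 2) ^ (d + 1)"
    by (subst sum.cong[OF refl W]) auto
  also have "\<dots> \<le> real (2 * (d + 2)) * (1 / 2) ^ (d + 1)"
    using card by (intro mult_right_mono) (simp_all only: of_nat_le_iff zero_le_power zero_le_divide_1_iff zero_le_numeral)
  also have "\<dots> = (real d + 2) / 2 ^ d"
    by (simp add: power_one_over field_simps)
  finally show ?thesis .
qed

lemma extensions_subset_layer:
  assumes "A \<in> layer d" "X \<subseteq> A"
  shows "extensions d (A, X) \<subseteq> layer d"
proof
  fix S assume "S \<in> extensions d (A, X)"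
  then obtain Y where Y: "Y \<subseteq> {1..2 * d} - A" "card Y = d - card X" "S = X \<union> Y"
    by (auto simp: extensions_def)
  have "card X \<le> d" "finite X" "finite Y"
    using Y layerD[OF assms(1)] card_mono[of A X] assms(2) finite_subset[of X A]
      finite_subset[of Y "{1..2 * d}"] by auto
  moreover have "X \<inter> Y = {}"
    using assms Y by auto
  ultimately show "S \<in> layer d"
    using Y assms by (auto simp: layer_def card_Un_disjoint)
qed

lemma card_extensions:
  assumes "A \<in> layer d" "X \<subseteq> A"
  shows "card (extensions d (A, X)) = d choose card X"
proof -
  have "card X \<le> d"
    using assms(2) card_mono[of A X] layerD[OF assms(1)] by simp
  moreover have "card ({1..2 * d} - A) = d"
    using layer_compl[OF assms(1)] by (simp add: layer_def)
  ultimately have "card {Y. Y \<subseteq> {1..2 * d} - A \<and> card Y = d - card X} = d choose card X"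
    by (simp add: n_subsets binomial_symmetric[symmetric])
  moreover have "inj_on (\<lambda>Y. X \<union> Y) {Y. Y \<subseteq> {1..2 * d} - A \<and> card Y = d - card X}"
    using assms(2) by (intro inj_onI) blast
  ultimately show ?thesis
    by (simp add: extensions_def card_image)
qed

text \<open>All extensions contain the nonempty \<open>X\<close>, so they form an intersecting
  family and \<open>prob_picks_pattern\<close> applies with the pattern that is constantly
  false.\<close>

lemma prob_missed:
  assumes "A \<in> layer d" "X \<subseteq> A" "X \<noteq> {}" "d > 0"
  shows "measure_pmf.prob (choice_pmf d) (missed d (A, X)) = (1 / 2) ^ (d choose card X)"
proof -
  have "missed d (A, X) = {f. \<forall>S\<in>extensions d (A, X). picks d f S = False}"
    by (simp add: missed_eq)
  also have "measure_pmf.prob (choice_pmf d) \<dots> = (1 / 2) ^ card (extensions d (A, X))"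
    using assms extensions_subset_layer[of A d X]
    by (intro prob_picks_pattern) (auto simp: extensions_def)
  finally show ?thesis
    using assms by (simp add: card_extensions)
qed

section \<open>From good choices to almost shattering\<close>

lemma picks_compl:
  assumes "A \<in> layer d" "f \<in> set_pmf (choice_pmf d)" "d > 0"
  shows "picks d f ({1..2 * d} - A) \<longleftrightarrow> \<not> picks d f A"
proof -
  have "compl_pair d A \<in> compl_pairs d"
    using assms by (auto simp: compl_pairs_eq)
  then have "f (compl_pair d A) \<in> set_pmf (pmf_of_set (compl_pair d A))"
    using assms set_Pi_pmf[of "compl_pairs d" "{}" "\<lambda>P. pmf_of_set P"]
    by (auto simp: choice_pmf_def PiE_dflt_def)
  then have "f (compl_pair d A) = A \<or> f (compl_pair d A) = {1..2 * d} - A"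
    by (subst (asm) set_pmf_of_set) (auto simp: compl_pair_def)
  then show ?thesis
    using layer_neq_compl[OF assms(1,3)] compl_pair_compl[OF assms(1)] by (auto simp: picks_def)
qed

lemma picked_family:
  assumes "f \<in> set_pmf (choice_pmf d)" "d > 0"
  shows "f ` compl_pairs d = {S \<in> layer d. picks d f S}"
proof (intro equalityI subsetI)
  fix S assume "S \<in> f ` compl_pairs d"
  then obtain A where A: "A \<in> layer d" "S = f (compl_pair d A)"
    by (auto simp: compl_pairs_eq)
  have "picks d f A \<or> picks d f ({1..2 * d} - A)"
    using picks_compl[OF A(1) assms] by blast
  then have "S = A \<or> S = {1..2 * d} - A"
    using compl_pair_compl[OF A(1)] A(2) by (auto simp: picks_def)
  then show "S \<in> {S \<in> layer d. picks d f S}"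
    using A layer_compl[OF A(1)] compl_pair_compl[OF A(1)] by (auto simp: picks_def)
next
  fix S assume "S \<in> {S \<in> layer d. picks d f S}"
  then have "compl_pair d S \<in> compl_pairs d" "S = f (compl_pair d S)"
    by (auto simp: picks_def compl_pairs_eq)
  then show "S \<in> f ` compl_pairs d"
    by (rule image_eqI[rotated])
qed

text \<open>The source of the threshold 2 in \<open>near_constant\<close>: one index may be the
  exceptional point \<open>x\<close>, and another must remain.\<close>

lemma card_ge_2_other_elem:
  assumes "card S \<ge> 2"
  obtains y where "y \<in> S" "y \<noteq> x"
proof -
  have "\<not> S \<subseteq> {x}"
    using assms card_mono[of "{x}" S] by auto
  then show ?thesis
    using that by auto
qed

lemma mem_restriction_picked:
  assumes "f \<in> set_pmf (choice_pmf d)" "d > 0" "S \<in> layer d" "picks d f S" "S \<inter> A = X"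
  shows "X \<in> restriction (f ` compl_pairs d) A"
proof -
  have "S \<in> f ` compl_pairs d"
    using picked_family[OF assms(1,2)] assms(3,4) by simp
  then show ?thesis
    unfolding restriction_def using assms(5) by blast
qed

lemma good_choice_shatters:
  assumes f: "f \<in> set_pmf (choice_pmf d)" and d: "d \<ge> 2"
    and nc: "\<And>B. B \<subseteq> {1..2 * d} \<Longrightarrow> card B = d + 1 \<Longrightarrow> f \<notin> near_constant d B"
    and ms: "\<And>A X. A \<in> layer d \<Longrightarrow> X \<subseteq> A \<Longrightarrow> 2 \<le> card X \<Longrightarrow> card X \<le> d - 2 \<Longrightarrow> f \<notin> missed d (A, X)"
    and A: "A \<in> layer d" and X: "X \<noteq> {}" "X \<subset> A"
  shows "X \<in> restriction (f ` compl_pairs d) A"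
proof -
  note mem = mem_restriction_picked[OF f, of _ A X]
  note finA = layerD[OF A]
  have "card X < d" "card X > 0"
    using X finA psubset_card_mono[of A X] finite_subset[of X A] by (auto simp: card_gt_0_iff)
  then consider "card X = 1" | "card (A - X) = 1" | "2 \<le> card X" "card X \<le> d - 2"
    using X finA card_Diff_subset[of X A] finite_subset[of X A] by fastforce
  then show ?thesis
  proof cases
    case 1
    then obtain x where x: "X = {x}" "x \<in> A" "x \<in> {1..2 * d}"
      using X finA by (auto simp: card_1_singleton_iff)
    \<comment> \<open>For \<open>y\<close> in \<open>B\<close> other than \<open>x\<close>, the
      facet \<open>B - {y}\<close> meets \<open>A\<close> exactly in \<open>x\<close>, so one such
      picked facet suffices.\<close>
    define B where "B = insert x ({1..2 * d} - A)"
    have B: "B \<subseteq> {1..2 * d}" "card B = d + 1"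
      using x layer_compl[OF A] by (auto simp: B_def layer_def)
    then have "card {y \<in> B. picks d f (B - {y})} \<ge> 2"
      using nc[of B] by (auto simp: near_constant_def)
    then obtain y where "y \<in> B" "picks d f (B - {y})" "y \<noteq> x"
      by (rule card_ge_2_other_elem[of _ x]) auto
    then show ?thesis
      using d x facets_subset_layer[OF B] by (intro mem[of "B - {y}"]) (auto simp: B_def facets_def)
  next
    case 2
    then obtain x where x: "A - X = {x}"
      by (auto simp: card_1_singleton_iff)
    then have X_eq: "X = A - {x}" "x \<in> A"
      using X by auto
    \<comment> \<open>For \<open>y\<close> in \<open>B\<close> other than \<open>x\<close>, the
      complement of \<open>B - {y}\<close> is \<open>A - {x}\<close> together with \<open>y\<close>,
      with trace \<open>X\<close> on \<open>A\<close>. It is picked when the facet is not.\<close>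
    define B where "B = insert x ({1..2 * d} - A)"
    have B: "B \<subseteq> {1..2 * d}" "card B = d + 1"
      using X_eq(2) finA layer_compl[OF A] by (auto simp: B_def layer_def)
    then have finB: "finite B"
      using finite_subset by blast
    have "card (B - {y \<in> B. picks d f (B - {y})}) = card B - card {y \<in> B. picks d f (B - {y})}"
      using finB by (intro card_Diff_subset) auto
    then have "card (B - {y \<in> B. picks d f (B - {y})}) \<ge> 2"
      using nc[of B] B by (auto simp: near_constant_def)
    then obtain y where y: "y \<in> B" "\<not> picks d f (B - {y})" "y \<noteq> x"
      by (rule card_ge_2_other_elem[of _ x]) auto
    have "B - {y} \<in> layer d"
      using facets_subset_layer[OF B] y by (auto simp: facets_def)
    moreover from this have "picks d f ({1..2 * d} - (B - {y}))"
      using picks_compl[OF _ f, of "B - {y}"] y d by simp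
    ultimately show ?thesis
      using d y X_eq finA by (intro mem[of "{1..2 * d} - (B - {y})"] layer_compl) (auto simp: B_def)
  next
    case 3
    then obtain Y where Y: "Y \<subseteq> {1..2 * d} - A" "card Y = d - card X" "picks d f (X \<union> Y)"
      using ms[of A X] A X by (auto simp: missed_def)
    then show ?thesis
      using d X extensions_subset_layer[OF A, of X]
      by (intro mem[of "X \<union> Y"]) (auto simp: extensions_def)
  qed
qed

text \<open>By cardinality only \<open>A\<close> itself can have trace \<open>A\<close>, and only
  its complement can have trace \<open>{}\<close>; exactly one of the two is picked.\<close>

lemma good_choice_almost_shatters:
  assumes f: "f \<in> set_pmf (choice_pmf d)" and d: "d > 0" and A: "A \<in> layer d"
    and mid: "\<And>X. X \<noteq> {} \<Longrightarrow> X \<subset> A \<Longrightarrow> X \<in> restriction (f ` compl_pairs d) A"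
  shows "almost_shatters (f ` compl_pairs d) A"
proof -
  define R where "R = restriction (f ` compl_pairs d) A"
  have R: "R = (\<lambda>S. S \<inter> A) ` {S \<in> layer d. picks d f S}"
    by (simp add: R_def restriction_def picked_family[OF f d])
  have sub: "R \<subseteq> Pow A"
    by (auto simp: R)
  note finA = layerD[OF A]
  have top: "A \<in> R \<longleftrightarrow> picks d f A"
  proof
    assume "A \<in> R"
    then obtain S where S: "S \<in> layer d" "picks d f S" "A \<subseteq> S"
      by (auto simp: R)
    then have "S = A"
      using finA layerD[OF S(1)] card_subset_eq[of S A] by simp
    then show "picks d f A" using S by simp
  next
    assume "picks d f A"
    then have "A \<in> {S \<in> layer d. picks d f S}"
      using A by simp
    then have "A \<inter> A \<in> R"
      unfolding R by (rule imageI)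
    then show "A \<in> R"
      by simp
  qed
  have bot: "{} \<in> R \<longleftrightarrow> picks d f ({1..2 * d} - A)"
  proof
    assume "{} \<in> R"
    then obtain S where S: "S \<in> layer d" "picks d f S" "S \<inter> A = {}"
      by (auto simp: R)
    then have "S \<subseteq> {1..2 * d} - A"
      by (auto simp: layer_def)
    then have "S = {1..2 * d} - A"
      using layerD[OF S(1)] layerD[OF layer_compl[OF A]] card_subset_eq[of "{1..2 * d} - A" S] by simp
    then show "picks d f ({1..2 * d} - A)" using S by simp
  next
    assume "picks d f ({1..2 * d} - A)"
    then have "{1..2 * d} - A \<in> {S \<in> layer d. picks d f S}"
      using layer_compl[OF A] by simp
    then have "({1..2 * d} - A) \<inter> A \<in> R"
      unfolding R by (rule imageI)
    moreover have "({1..2 * d} - A) \<inter> A = {}"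
      by blast
    ultimately show "{} \<in> R"
      by simp
  qed
  have mid': "X = {} \<or> X = A \<or> X \<in> R" if "X \<subseteq> A" for X
    using mid[of X] that by (auto simp: R_def)
  have "R = Pow A - {if picks d f A then {} else A}"
  proof (intro equalityI subsetI)
    fix X assume "X \<in> R"
    then show "X \<in> Pow A - {if picks d f A then {} else A}"
      using sub top bot picks_compl[OF A f d] by (cases "picks d f A") auto
  next
    fix X assume "X \<in> Pow A - {if picks d f A then {} else A}"
    then show "X \<in> R"
      using mid'[of X] top bot picks_compl[OF A f d] by (cases "picks d f A") auto
  qed
  then have "R = Pow A - {{}} \<or> R = Pow A - {A}"
    by (cases "picks d f A") simp_all
  then show ?thesis
    by (simp add: almost_shatters_def R_def)
qed

section \<open>Dependencies between the bad events\<close>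

definition large_sets :: "nat \<Rightarrow> nat set set" where
  "large_sets d = {B. B \<subseteq> {1..2 * d} \<and> card B = d + 1}"

definition middle_traces :: "nat \<Rightarrow> (nat set \<times> nat set) set" where
  "middle_traces d = {(A, X). A \<in> layer d \<and> X \<subseteq> A \<and> 2 \<le> card X \<and> card X \<le> d - 2}"

lemma finite_large_sets [simp]: "finite (large_sets d)"
  by (rule finite_subset[of _ "Pow {1..2 * d}"]) (auto simp: large_sets_def)

lemma middle_traces_subset: "middle_traces d \<subseteq> Sigma (layer d) Pow"
  by (auto simp: middle_traces_def)

lemma finite_Sigma_layer_Pow: "finite (Sigma (layer d) Pow)"
  by (intro finite_SigmaI) (auto dest: layerD)

lemma finite_middle_traces [simp]: "finite (middle_traces d)"
  using middle_traces_subset finite_Sigma_layer_Pow by (rule finite_subset)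

text \<open>At most \<open>2 ^ (2 * d)\<close> choices of \<open>A\<close> and \<open>2 ^ d\<close>
  of \<open>X\<close>. The crude count suffices because the weight of these events can absorb
  it.\<close>

lemma card_middle_traces: "card (middle_traces d) \<le> 2 ^ (3 * d)"
proof -
  have "card (middle_traces d) \<le> card (Sigma (layer d) Pow)"
    using middle_traces_subset finite_Sigma_layer_Pow by (intro card_mono)
  also have "\<dots> = (\<Sum>A\<in>layer d. card (Pow A))"
    by (intro card_SigmaI) (auto dest: layerD)
  also have "\<dots> = (\<Sum>A\<in>layer d. 2 ^ d)"
    by (intro sum.cong refl) (simp add: card_Pow layerD)
  also have "\<dots> = card (layer d) * 2 ^ d"
    by simp
  also have "card (layer d) \<le> card (Pow {1..2 * d})"
    by (intro card_mono) (auto simp: layer_def)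
  also have "card (Pow {1..2 * d}) = 2 ^ (2 * d)"
    by (simp add: card_Pow)
  finally show ?thesis
    by (simp add: power_add[symmetric])
qed

text \<open>Only neighbours that are large sets are collected here and in
  \<open>missed_nbrs\<close>; the middle traces are later made neighbours of every event.\<close>

definition near_nbrs :: "nat \<Rightarrow> nat set \<Rightarrow> nat set set" where
  "near_nbrs d B = {B' \<in> large_sets d. B' \<noteq> B \<and>
     compl_pair d ` facets B \<inter> compl_pair d ` facets B' \<noteq> {}}"

definition missed_nbrs :: "nat \<Rightarrow> nat set \<times> nat set \<Rightarrow> nat set set" where
  "missed_nbrs d Q = {B \<in> large_sets d. compl_pair d ` extensions d Q \<inter> compl_pair d ` facets B \<noteq> {}}"

text \<open>The summands count the two ways to share a pair: through a common facet, or through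
  complementary facets.\<close>

definition max_deg :: "nat \<Rightarrow> nat" where
  "max_deg d = (d + 1) * (d - 1) + (d + 1 choose 2)"

lemma card_near_nbrs:
  assumes B: "B \<in> large_sets d"
  shows "card (near_nbrs d B) \<le> max_deg d"
proof -
  define U where "U = {1..2 * d}"
  have finB: "finite B" "B \<subseteq> U" "card B = d + 1" "finite U"
    using B finite_subset[of B U] by (auto simp: large_sets_def U_def)
  \<comment> \<open>Common facet: a point of \<open>B\<close> is exchanged for one of the
    \<open>d - 1\<close> points outside.\<close>
  define \<N>1 where "\<N>1 = (\<lambda>(y, z). insert z (B - {y})) ` (B \<times> (U - B))"
  \<comment> \<open>Complementary facets: the neighbour is the complement of \<open>B\<close>
    enlarged by the two removed points, both from \<open>B\<close>.\<close>
  define \<N>2 where "\<N>2 = (\<lambda>P. (U - B) \<union> P) ` {P. P \<subseteq> B \<and> card P = 2}"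
  have "near_nbrs d B \<subseteq> \<N>1 \<union> \<N>2"
  proof
    fix B' assume "B' \<in> near_nbrs d B"
    then obtain y y' where B': "B' \<subseteq> U" "B' \<noteq> B" "y \<in> B" "y' \<in> B'"
        "compl_pair d (B - {y}) = compl_pair d (B' - {y'})"
      by (auto simp: near_nbrs_def facets_def U_def large_sets_def)
    then consider "B - {y} = B' - {y'}" | "B - {y} = U - (B' - {y'})"
      using compl_pair_eqD unfolding U_def by blast
    then show "B' \<in> \<N>1 \<union> \<N>2"
    proof cases
      case 1
      then have eq: "B' = insert y' (B - {y})"
        using B' by auto
      \<comment> \<open>If \<open>y'\<close> were in \<open>B\<close>, it would equal
        \<open>y\<close>, and then \<open>B'\<close> would be \<open>B\<close>.\<close>
      moreover have "y' \<in> U - B"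
        using 1 B' by blast
      ultimately show ?thesis
        using B'(3) unfolding \<N>1_def by (intro UnI1 image_eqI[of _ _ "(y, y')"]) auto
    next
      case 2
      have "B' = (U - B) \<union> {y, y'}" "{y, y'} \<subseteq> B" "y \<noteq> y'"
        using 2 B' finB(2) by blast+
      then show ?thesis
        unfolding \<N>2_def by (intro UnI2 image_eqI[of _ _ "{y, y'}"]) auto
    qed
  qed
  moreover have "finite \<N>1" "finite \<N>2"
    using finB by (auto simp: \<N>1_def \<N>2_def)
  ultimately have "card (near_nbrs d B) \<le> card (\<N>1 \<union> \<N>2)"
    by (intro card_mono) auto
  also have "\<dots> \<le> card \<N>1 + card \<N>2"
    by (rule card_Un_le)
  also have "\<dots> \<le> card (B \<times> (U - B)) + card {P. P \<subseteq> B \<and> card P = 2}"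
    unfolding \<N>1_def \<N>2_def using finB by (intro add_mono card_image_le) auto
  also have "\<dots> = max_deg d"
    using finB by (simp add: max_deg_def card_cartesian_product n_subsets card_Diff_subset U_def)
  finally show ?thesis .
qed

lemma card_missed_nbrs:
  assumes "A \<in> layer d" "X \<subseteq> A"
  shows "card (missed_nbrs d (A, X)) \<le> 2 * d * (d choose card X)"
proof -
  define U where "U = {1..2 * d}"
  \<comment> \<open>A neighbour is decoded from an extension \<open>S\<close> in the shared pair and
    the removed point \<open>z\<close>: the facet is \<open>U - S\<close> if \<open>z\<close> lies
    in \<open>S\<close>, and \<open>S\<close> otherwise.\<close>
  define h where "h = (\<lambda>(S, z). insert z (if z \<in> S then U - S else S))"
  have fin: "finite (extensions d (A, X))"
    using extensions_subset_layer[OF assms] finite_layer finite_subset by blast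
  have "missed_nbrs d (A, X) \<subseteq> h ` (extensions d (A, X) \<times> U)"
  proof
    fix B assume "B \<in> missed_nbrs d (A, X)"
    then obtain S y where B: "B \<subseteq> U" "y \<in> B" "S \<in> extensions d (A, X)"
        "compl_pair d S = compl_pair d (B - {y})"
      by (auto simp: missed_nbrs_def facets_def U_def large_sets_def)
    then have "S = B - {y} \<or> S = U - (B - {y})"
      using compl_pair_eqD unfolding U_def by blast
    then have "B = h (S, y)"
      using B by (auto simp: h_def)
    then show "B \<in> h ` (extensions d (A, X) \<times> U)"
      using B by auto
  qed
  then have "card (missed_nbrs d (A, X)) \<le> card (h ` (extensions d (A, X) \<times> U))"
    using fin by (intro card_mono) (auto simp: U_def)
  also have "\<dots> \<le> card (extensions d (A, X) \<times> U)"
    using fin by (intro card_image_le) (auto simp: U_def)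
  also have "\<dots> = 2 * d * (d choose card X)"
    using card_extensions[OF assms] by (simp add: card_cartesian_product U_def)
  finally show ?thesis .
qed

section \<open>Numerical conditions of the local lemma\<close>

text \<open>For positive \<open>n\<close> the power is the reciprocal of
  \<open>(1 + 1 / real n) ^ n\<close>, which is at most \<open>exp 1\<close> and so at most
  3.\<close>

lemma pow_ge_third: "(1 - 1 / (real n + 1)) ^ n \<ge> 1 / 3"
proof (cases "n = 0")
  case False
  have "(1 + 1 / real n) ^ n \<le> exp (1 / real n) ^ n"
    by (intro power_mono exp_ge_add_one_self) auto
  also have "\<dots> = exp 1"
    using False by (simp flip: exp_of_nat_mult)
  also have "\<dots> \<le> 3"
    by (rule exp_le)
  finally have "1 / 3 \<le> 1 / (1 + 1 / real n) ^ n"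
    by (intro divide_left_mono) (auto intro!: mult_pos_pos zero_less_power add_pos_nonneg)
  also have "\<dots> = (1 - 1 / (real n + 1)) ^ n"
    using False by (simp add: field_simps flip: power_one_over power_divide)
  finally show ?thesis .
qed simp

lemma max_deg_eq: "d > 0 \<Longrightarrow> 2 * real (max_deg d + 1) = real d * (3 * real d + 1)"
proof -
  assume "d > 0"
  have "2 * (d + 1 choose 2) = (d + 1) * d"
    by (simp add: choose_two)
  then have "2 * real (d + 1 choose 2) = (real d + 1) * real d"
    by (metis of_nat_1 of_nat_add of_nat_mult of_nat_numeral)
  then show ?thesis
    using \<open>d > 0\<close> by (simp add: max_deg_def of_nat_diff algebra_simps)
qed

text \<open>The constants come from \<open>1 / 3 * (15 / 16) = 5 / 16\<close> and
  \<open>max_deg_eq\<close>. At 14 the sides are 77056 and 81920; at 13 they would be 62400 and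
  40960, so the threshold on \<open>d\<close> is sharp here.\<close>

lemma cubic_le_power2:
  assumes "d \<ge> (14::nat)"
  shows "8 * (d + 2) * d * (3 * d + 1) \<le> 5 * 2 ^ d"
  using assms
proof (induction d rule: dec_induct)
  case (step n)
  have "8 * (Suc n + 2) * Suc n * (3 * Suc n + 1) \<le> 2 * (8 * (n + 2) * n * (3 * n + 1))"
  proof -
    \<comment> \<open>After this shift the claim is a coefficientwise comparison of polynomials in
      \<open>k\<close>.\<close>
    obtain k where k: "n = k + 14"
      using step.hyps by (metis le_add_diff_inverse2)
    show ?thesis
      unfolding k by (simp add: algebra_simps)
  qed
  then show ?case
    using step.IH by simp
qed simp

text \<open>The local lemma condition for large sets, with the weight of the symmetric case; the
  factor \<open>15 / 16\<close> pays for all middle traces at once.\<close>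

lemma near_bound:
  assumes "d \<ge> 14"
  shows "(real d + 2) / 2 ^ d \<le> 1 / real (max_deg d + 1) * ((1 - 1 / real (max_deg d + 1)) ^ max_deg d * (15 / 16))"
proof -
  have "real (8 * (d + 2) * d * (3 * d + 1)) \<le> real (5 * 2 ^ d)"
    using cubic_le_power2[OF assms] by (simp only: of_nat_le_iff)
  then have "8 * (real d + 2) * (real d * (3 * real d + 1)) \<le> 5 * 2 ^ d"
    by (simp add: algebra_simps)
  then have "8 * (real d + 2) * (2 * real (max_deg d + 1)) \<le> 5 * 2 ^ d"
    using max_deg_eq[of d] assms by (simp only:)
  then have "(real d + 2) / 2 ^ d \<le> 1 / real (max_deg d + 1) * (1 / 3 * (15 / 16))"
    by (simp add: field_simps)
  also have "\<dots> \<le> 1 / real (max_deg d + 1) * ((1 - 1 / real (max_deg d + 1)) ^ max_deg d * (15 / 16))"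
    using pow_ge_third[of "max_deg d"] by (intro mult_left_mono mult_right_mono) (auto simp: add_ac)
  finally show ?thesis .
qed

text \<open>The factorisation \<open>1 / 2 = 5 / 9 * (9 / 10)\<close> splits the budget: powers of
  \<open>9 / 10\<close> pay for up to \<open>2 * d * m\<close> large neighbours, powers of
  \<open>5 / 9\<close> for the weight and the factor \<open>15 / 16\<close>.\<close>

lemma missed_bound:
  assumes d: "d \<ge> 14" and m: "m \<ge> 6 * d"
  shows "(1 / 2) ^ m \<le> (1 / 2) ^ (3 * d + 4) *
    ((1 - 1 / real (max_deg d + 1)) ^ (2 * d * m) * (15 / 16))"
proof -
  have "1 / real (max_deg d + 1) = 2 / (real d * (3 * real d + 1))"
    using max_deg_eq[of d] d by (simp add: field_simps)
  then have "2 * real d * (1 / real (max_deg d + 1)) = 4 / (3 * real d + 1)"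
    using d by simp
  also have "\<dots> \<le> 1 / 10"
    using d by (simp add: field_simps)
  finally have "9 / 10 \<le> 1 + real (2 * d) * (- (1 / real (max_deg d + 1)))"
    by simp
  \<comment> \<open>By Bernoulli, each of the \<open>m\<close> blocks of \<open>2 * d\<close>
    neighbour factors keeps at least \<open>9 / 10\<close>.\<close>
  also have "\<dots> \<le> (1 + - (1 / real (max_deg d + 1))) ^ (2 * d)"
    by (intro Bernoulli_inequality) simp
  finally have "(9 / 10) ^ m \<le> ((1 - 1 / real (max_deg d + 1)) ^ (2 * d)) ^ m"
    by (intro power_mono) auto
  then have P: "(9 / 10) ^ m \<le> (1 - 1 / real (max_deg d + 1)) ^ (2 * d * m)"
    by (simp add: power_mult)
  have "(5 / 9 :: real) ^ m \<le> (5 / 9) ^ (6 * d)"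
    using m by (intro power_decreasing) auto
  also have "\<dots> = ((5 / 9) ^ 6) ^ d"
    by (simp add: power_mult)
  \<comment> \<open>Here \<open>15625 / 531441\<close> is below \<open>1 / 32\<close>; this is why
    six times \<open>d\<close> is enough for \<open>m\<close>.\<close>
  also have "\<dots> \<le> ((1 / 2) ^ 5) ^ d"
    by (intro power_mono) (auto simp: power_divide)
  also have "\<dots> = (1 / 2) ^ (5 * d)"
    by (simp add: power_mult)
  also have "\<dots> \<le> (1 / 2) ^ (3 * d + 4 + 1)"
    using d by (intro power_decreasing) auto
  also have "\<dots> \<le> (1 / 2) ^ (3 * d + 4) * (15 / 16)"
    unfolding power_add by (intro mult_left_mono) auto
  finally have Q: "(5 / 9 :: real) ^ m \<le> (1 / 2) ^ (3 * d + 4) * (15 / 16)" .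
  have "(1 / 2 :: real) ^ m = (5 / 9) ^ m * (9 / 10) ^ m"
    by (simp flip: power_mult_distrib)
  also have "\<dots> \<le> ((1 / 2) ^ (3 * d + 4) * (15 / 16)) * (1 - 1 / real (max_deg d + 1)) ^ (2 * d * m)"
    using P Q by (intro mult_mono) auto
  finally show ?thesis
    by (simp add: mult_ac)
qed

text \<open>Symmetry and monotonicity up to the middle reduce the range to
  \<open>d choose 2\<close>, and \<open>d - 1\<close> is at least 12.\<close>

lemma middle_binomial_ge:
  assumes "d \<ge> 14" "2 \<le> k" "k \<le> d - 2"
  shows "d choose k \<ge> 6 * d"
proof -
  have "d choose 2 \<le> d choose k"
  proof (cases "2 * k \<le> d")
    case True
    then show ?thesis
      using assms by (intro binomial_mono) auto
  next
    case False
    then have "d choose 2 \<le> d choose (d - k)"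
      using assms by (intro binomial_mono) auto
    then show ?thesis
      using assms by (simp add: binomial_symmetric[of k d])
  qed
  moreover have "6 * d * 2 \<le> d * (d - 1)"
    using assms by simp
  then have "6 * d * 2 div 2 \<le> d * (d - 1) div 2"
    by (rule div_le_mono)
  then have "6 * d \<le> d choose 2"
    unfolding choose_two by simp
  ultimately show ?thesis
    by simp
qed

section \<open>Application of the local lemma and transfer to the random family\<close>

lemma prob_good_choice_pos:
  assumes d: "d \<ge> 14"
  shows "measure_pmf.prob (choice_pmf d)
    (- ((\<Union>B\<in>large_sets d. near_constant d B) \<union> (\<Union>Q\<in>middle_traces d. missed d Q))) > 0"
proof -
  define I where "I = Inl ` large_sets d \<union> Inr ` middle_traces d"
  define E where "E = case_sum (near_constant d) (missed d)"
  define D where "D = case_sum (\<lambda>B. compl_pair d ` facets B) (\<lambda>Q. compl_pair d ` extensions d Q)"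
  \<comment> \<open>Every middle trace neighbours every event, itself included, so only pairs shared
    with large sets have to be counted.\<close>
  define N :: "nat set + nat set \<times> nat set \<Rightarrow> (nat set + nat set \<times> nat set) set"
    where "N i = Inl ` case_sum (near_nbrs d) (missed_nbrs d) i \<union> Inr ` middle_traces d" for i
  \<comment> \<open>The exponent of \<open>v\<close> keeps the total weight of the at most
    \<open>2 ^ (3 * d)\<close> middle traces within \<open>1 / 16\<close>.\<close>
  define u v where "u = 1 / real (max_deg d + 1)" and "v = (1 / 2 :: real) ^ (3 * d + 4)"
  define x :: "nat set + nat set \<times> nat set \<Rightarrow> real" where "x = case_sum (\<lambda>_. u) (\<lambda>_. v)"
  have "0 < (d + 1) * (d - 1)"
    using d by simp
  then have "0 < max_deg d"
    by (simp add: max_deg_def)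
  then have uv: "0 < u" "u < 1" "0 < v" "v < 1"
    by (auto simp: u_def v_def power_less_one_iff)
  have det: "determined_on (D i) (E i)" for i
    by (cases i) (simp_all add: D_def E_def determined_on_near_constant determined_on_missed)
  have D_sub: "D i \<subseteq> compl_pairs d" if "i \<in> I" for i
  proof (cases i)
    case (Inl B)
    then have "facets B \<subseteq> layer d"
      using that by (intro facets_subset_layer) (auto simp: I_def large_sets_def)
    then show ?thesis
      unfolding D_def Inl compl_pairs_eq by (simp add: image_mono)
  next
    case (Inr Q)
    then have "extensions d (fst Q, snd Q) \<subseteq> layer d"
      using that by (intro extensions_subset_layer) (auto simp: I_def middle_traces_def)
    then show ?thesis
      unfolding D_def Inr compl_pairs_eq by (simp add: image_mono)
  qed
  have D_disj: "D i \<inter> D j = {}" if "i \<in> I" "j \<in> I" "j \<notin> N i" "j \<noteq> i" for i j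
    using that by (cases i; cases j)
      (auto simp: I_def D_def N_def near_nbrs_def missed_nbrs_def)
  have "real (card (middle_traces d)) \<le> real (2 ^ (3 * d))"
    using card_middle_traces by (simp only: of_nat_le_iff)
  then have "real (card (middle_traces d)) * v \<le> 2 ^ (3 * d) * v"
    using uv by (intro mult_right_mono) auto
  also have "\<dots> = 1 / 16"
    by (simp add: v_def power_add power_one_over)
  finally have mid: "15 / 16 \<le> (\<Prod>Q\<in>middle_traces d. 1 - v)"
    using one_minus_sum_le_prod[of "middle_traces d" "\<lambda>_. v"] uv by simp
  have prod_N: "(1 - u) ^ n * (15 / 16) \<le> (\<Prod>j\<in>N i. 1 - x j)"
    if "finite S" "card S \<le> n" "N i = Inl ` S \<union> Inr ` middle_traces d" for i n S
  proof -
    have split: "(\<Prod>j\<in>N i. 1 - x j) = (\<Prod>B\<in>S. 1 - u) * (\<Prod>Q\<in>middle_traces d. 1 - v)"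
      using that by (subst that(3), subst prod.union_disjoint) (auto simp: prod.reindex x_def)
    have le: "(1 - u) ^ n \<le> (\<Prod>B\<in>S. 1 - u)"
      using that uv by (simp add: power_decreasing)
    show ?thesis
      unfolding split using uv by (intro mult_mono le mid prod_nonneg) auto
  qed
  have "measure_pmf.prob (choice_pmf d) (space (measure_pmf (choice_pmf d)) - (\<Union>i\<in>I. E i)) > 0"
  proof (rule measure_pmf.lovasz_local_lemma[where x = x and N = N])
    show "finite I"
      by (simp add: I_def)
    show "N i \<subseteq> I" for i
      by (cases i) (auto simp: N_def I_def near_nbrs_def missed_nbrs_def)
    show "0 \<le> x i \<and> x i < 1" for i
      using uv by (cases i) (auto simp: x_def)
    show "measure_pmf.prob (choice_pmf d) (E i) \<le> x i * (\<Prod>j\<in>N i. 1 - x j)" if "i \<in> I" for i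
    proof (cases i)
      case (Inl B)
      then have B: "B \<in> large_sets d"
        using that by (auto simp: I_def)
      have "measure_pmf.prob (choice_pmf d) (E i) \<le> (real d + 2) / 2 ^ d"
        using B d prob_near_constant[of B d] by (simp add: E_def Inl large_sets_def)
      also have "\<dots> \<le> u * ((1 - u) ^ max_deg d * (15 / 16))"
        using near_bound[OF d] by (simp only: u_def)
      also have "\<dots> \<le> u * (\<Prod>j\<in>N i. 1 - x j)"
        using uv card_near_nbrs[OF B]
        by (intro mult_left_mono prod_N[of "near_nbrs d B"]) (auto simp: N_def Inl near_nbrs_def)
      finally show ?thesis
        by (simp add: x_def Inl)
    next
      case (Inr Q)
      obtain A X where Q: "Q = (A, X)"
        by (cases Q)
      have AX: "A \<in> layer d" "X \<subseteq> A" "2 \<le> card X" "card X \<le> d - 2"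
        using that by (auto simp: I_def Inr Q middle_traces_def)
      then have "X \<noteq> {}"
        by auto
      then have "measure_pmf.prob (choice_pmf d) (E i) = (1 / 2) ^ (d choose card X)"
        using AX d prob_missed[of A d X] by (auto simp: E_def Inr Q)
      also have "\<dots> \<le> v * ((1 - u) ^ (2 * d * (d choose card X)) * (15 / 16))"
        using missed_bound[OF d middle_binomial_ge[OF d AX(3,4)]] by (simp only: u_def v_def)
      also have "\<dots> \<le> v * (\<Prod>j\<in>N i. 1 - x j)"
        using uv card_missed_nbrs[OF AX(1,2)]
        by (intro mult_left_mono prod_N[of "missed_nbrs d Q"]) (auto simp: N_def Inr Q missed_nbrs_def)
      finally show ?thesis
        by (simp add: x_def Inr)
    qed
    show "measure_pmf.prob (choice_pmf d) (E i \<inter> (space (measure_pmf (choice_pmf d)) - (\<Union>j\<in>J. E j))) =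
        measure_pmf.prob (choice_pmf d) (E i) *
        measure_pmf.prob (choice_pmf d) (space (measure_pmf (choice_pmf d)) - (\<Union>j\<in>J. E j))"
      if "i \<in> I" "J \<subseteq> I - N i - {i}" for i J
    proof -
      \<comment> \<open>Non-neighbours read none of the pairs that \<open>E i\<close> reads, so
        avoiding all of them is determined on the remaining pairs.\<close>
      have "D j \<subseteq> compl_pairs d - D i" if "j \<in> J" for j
        using that \<open>i \<in> I\<close> \<open>J \<subseteq> I - N i - {i}\<close> D_sub[of j] D_disj[of i j] by blast
      then have "determined_on (compl_pairs d - D i) (- (\<Union>j\<in>J. E j))"
        using det by (intro determined_on_not_Union[where D = D])
      then show ?thesis
        unfolding choice_pmf_def space_measure_pmf Compl_eq_Diff_UNIV[symmetric]
        using det[of i] D_sub[OF that(1)]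
        by (intro Pi_pmf_determined_on_indep[where C = "D i" and D = "compl_pairs d - D i"]) auto
    qed
  qed auto
  also have "space (measure_pmf (choice_pmf d)) - (\<Union>i\<in>I. E i) =
      - ((\<Union>B\<in>large_sets d. near_constant d B) \<union> (\<Union>Q\<in>middle_traces d. missed d Q))"
    by (auto simp: I_def E_def)
  finally show ?thesis .
qed

theorem theorem3:
  fixes d :: nat
  assumes "d \<ge> 14"
  shows "measure_pmf.prob (random_family d)
           {\<F>. \<forall>A \<in> layer d. \<forall>X. X \<noteq> {} \<and> X \<subset> A \<longrightarrow> X \<in> restriction \<F> A} > 0
       \<and> measure_pmf.prob (random_family d)
           {\<F>. \<forall>A \<in> layer d. almost_shatters \<F> A} > 0"
proof -
  define G where
    "G = - ((\<Union>B\<in>large_sets d. near_constant d B) \<union> (\<Union>Q\<in>middle_traces d. missed d Q))"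
  have fam: "random_family d = map_pmf (\<lambda>f. f ` compl_pairs d) (choice_pmf d)"
    by (simp add: random_family_def choice_pmf_def)
  have mid: "X \<in> restriction (f ` compl_pairs d) A"
    if "f \<in> G \<inter> set_pmf (choice_pmf d)" "A \<in> layer d" "X \<noteq> {}" "X \<subset> A" for f A X
    using that assms by (intro good_choice_shatters) (auto simp: G_def large_sets_def middle_traces_def)
  \<comment> \<open>Restricting to the support keeps the probability and ensures that
    \<open>f\<close> selects a member of each pair.\<close>
  have "0 < measure_pmf.prob (choice_pmf d) (G \<inter> set_pmf (choice_pmf d))"
    using prob_good_choice_pos[OF assms] by (simp add: G_def measure_Int_set_pmf)
  \<comment> \<open>One transfer serves both conjuncts: the preimage of either event contains all
    good choices in the support.\<close>
  then have pos: "0 < measure_pmf.prob (random_family d) {\<F>. P \<F>}"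
    if "\<And>f. f \<in> G \<inter> set_pmf (choice_pmf d) \<Longrightarrow> P (f ` compl_pairs d)" for P
    unfolding fam measure_map_pmf
    by (rule less_le_trans) (intro measure_pmf.finite_measure_mono, use that in auto)
  show ?thesis
  proof (intro conjI pos ballI allI impI)
    show "almost_shatters (f ` compl_pairs d) A"
      if "f \<in> G \<inter> set_pmf (choice_pmf d)" "A \<in> layer d" for f A
      using that assms mid by (intro good_choice_almost_shatters) auto
  qed (use mid in blast)
qed

end
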